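(* Let $A,B\in\mathcal{M}_n$ be positive definite matrices and $X\in\mathcal{M}_n$. Then for every $\nu\in[0,1]$ and every unitarily invariant norm $|||\cdot|||$ on matrices, $$|||A^{\nu}XB^{1-\nu}+A^{1-\nu}XB^{\nu}|||\le|||4r_1(\nu)A^{1/2}XB^{1/2}+(1-2r_1(\nu))(AX+XB)|||,$$ where $r_1(\nu)=\min\{\nu,|\tfrac12-\nu|,1-\nu\}$.
   Context: $\mathcal{M}_n$ is the algebra of $n\times n$ complex matrices. A unitarily invariant norm satisfies $|||UTV|||=|||T|||$ for all unitary $U,V$. *)

theory Defs
  imports "HOL-Analysis.Analysis"
begin

text \<open>
  The algebra of complex matrices of size \<open>n\<close> is the type \<open>complex^'n^'n\<close> with \<open>CARD('n) = n\<close>.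
\<close>

definition adjoint_matrix :: "complex^'n^'m \<Rightarrow> complex^'m^'n" where
  "adjoint_matrix A = map_matrix cnj (transpose A)"

definition unitary_matrix :: "complex^'n^'n \<Rightarrow> bool" where
  "unitary_matrix U \<longleftrightarrow> adjoint_matrix U ** U = mat 1 \<and> U ** adjoint_matrix U = mat 1"

text \<open>For Hermitian \<open>A\<close> the form \<open>x\<^sup>* A x\<close> is real, so taking its real part loses nothing.\<close>

definition positive_definite_matrix :: "complex^'n^'n \<Rightarrow> bool" where
  "positive_definite_matrix A \<longleftrightarrow>
     adjoint_matrix A = A \<and>
     (\<forall>x. x \<noteq> 0 \<longrightarrow> 0 < Re (\<Sum>i\<in>UNIV. cnj (x $ i) * (A *v x) $ i))"

definition real_diag_matrix :: "('n \<Rightarrow> real) \<Rightarrow> complex^'n^'n" where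
  "real_diag_matrix d = (\<chi> i j. if i = j then complex_of_real (d i) else 0)"

text \<open>
  Real powers by functional calculus: if \<open>A = U diag(d) U\<^sup>*\<close> with \<open>U\<close> unitary and \<open>d\<close> positive,
  then \<open>A\<^sup>t = U diag(d\<^sup>t) U\<^sup>*\<close>. Such a decomposition exists precisely for positive definite \<open>A\<close>;
  the lemma \<open>matrix_powr_eq\<close> below shows that the result does not depend on its choice. For other \<open>A\<close>
  the value is unspecified.
\<close>

definition matrix_powr :: "complex^'n^'n \<Rightarrow> real \<Rightarrow> complex^'n^'n" where
  "matrix_powr A t =
     (THE P. \<exists>U d. unitary_matrix U \<and> (\<forall>i. 0 < d i) \<and>
        A = U ** real_diag_matrix d ** adjoint_matrix U \<and>
        P = U ** real_diag_matrix (\<lambda>i. d i powr t) ** adjoint_matrix U)"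

lemma diag_mult_right: "(W ** real_diag_matrix d) $ i $ j = W $ i $ j * of_real (d j)"
  by (simp add: matrix_matrix_mult_def real_diag_matrix_def if_distrib cong: if_cong)

lemma diag_mult_left: "(real_diag_matrix d ** W) $ i $ j = of_real (d i) * W $ i $ j"
  by (simp add: matrix_matrix_mult_def real_diag_matrix_def if_distrib if_distribR cong: if_cong)

lemma unitary_diag_powr_unique:
  assumes U: "unitary_matrix U" and V: "unitary_matrix V"
    and eq: "U ** real_diag_matrix d ** adjoint_matrix U = V ** real_diag_matrix e ** adjoint_matrix V"
  shows "U ** real_diag_matrix (\<lambda>i. d i powr t) ** adjoint_matrix U =
         V ** real_diag_matrix (\<lambda>i. e i powr t) ** adjoint_matrix V"
proof -
  define W where "W = adjoint_matrix V ** U"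
  have *: "adjoint_matrix V ** (V ** M ** adjoint_matrix V) ** U = M ** W"
    "adjoint_matrix V ** (U ** M ** adjoint_matrix U) ** U = W ** M" for M
    using U V unfolding unitary_matrix_def W_def
    by (metis matrix_mul_assoc matrix_mul_lid matrix_mul_rid)+
  have "W ** real_diag_matrix d = real_diag_matrix e ** W"
    using * eq by metis
  then have "W $ i $ j * of_real (d j) = of_real (e i) * W $ i $ j" for i j
    by (metis diag_mult_left diag_mult_right)
  then have "W $ i $ j = 0 \<or> d j = e i" for i j
    by (metis mult.commute mult_cancel_left of_real_eq_iff)
  then have "W ** real_diag_matrix (\<lambda>i. d i powr t) = real_diag_matrix (\<lambda>i. e i powr t) ** W"
    by (simp add: vec_eq_iff diag_mult_left diag_mult_right) (metis mult.commute mult_zero_left)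
  then have "V ** (W ** real_diag_matrix (\<lambda>i. d i powr t)) ** adjoint_matrix U =
      V ** (real_diag_matrix (\<lambda>i. e i powr t) ** W) ** adjoint_matrix U"
    by simp
  then show ?thesis
    using U V unfolding unitary_matrix_def W_def
    by (metis matrix_mul_assoc matrix_mul_lid matrix_mul_rid)
qed

lemma matrix_powr_eq:
  assumes "unitary_matrix U" "\<And>i. 0 < d i"
    and "A = U ** real_diag_matrix d ** adjoint_matrix U"
  shows "matrix_powr A t = U ** real_diag_matrix (\<lambda>i. d i powr t) ** adjoint_matrix U"
  unfolding matrix_powr_def
  by (rule the_equality) (use assms unitary_diag_powr_unique in blast)+

definition matrix_norm :: "(complex^'n^'n \<Rightarrow> real) \<Rightarrow> bool" where
  "matrix_norm N \<longleftrightarrow>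
     (\<forall>T. 0 \<le> N T) \<and>
     (\<forall>T. N T = 0 \<longleftrightarrow> T = 0) \<and>
     (\<forall>c T. N (map_matrix (\<lambda>z. c * z) T) = cmod c * N T) \<and>
     (\<forall>S T. N (S + T) \<le> N S + N T)"

definition unitarily_invariant_norm :: "(complex^'n^'n \<Rightarrow> real) \<Rightarrow> bool" where
  "unitarily_invariant_norm N \<longleftrightarrow>
     matrix_norm N \<and>
     (\<forall>U T V. unitary_matrix U \<longrightarrow> unitary_matrix V \<longrightarrow> N (U ** T ** V) = N T)"

definition r1 :: "real \<Rightarrow> real" where
  "r1 \<nu> = Min {\<nu>, \<bar>1/2 - \<nu>\<bar>, 1 - \<nu>}"

end

theory Submission
  imports Defs
begin

text \<open>
  In eigenbases of \<open>A\<close> and \<open>B\<close>, with eigenvalues \<open>exp (2 p\<^sub>i)\<close> and \<open>exp (2 q\<^sub>j)\<close>, both sides are Schur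
  multiples of one matrix: with \<open>x = p\<^sub>i - q\<^sub>j\<close>, \<open>\<mu> = \<bar>1 - 2 \<nu>\<bar>\<close>, \<open>\<rho> = 2 r1 \<nu> = min \<mu> (1 - \<mu>)\<close> and
  \<open>cos \<phi> = \<rho> / (1 - \<rho>)\<close>, the multipliers are \<open>cosh (\<mu> x)\<close> on the left and
  \<open>(cosh x + cos \<phi>) / (1 + cos \<phi>)\<close> on the right. Both are infinite products of factors \<open>1 + c x\<^sup>2\<close>,
  and ordering the zeros by modulus, each coefficient \<open>c\<close> on the left is at most the corresponding one
  on the right. It remains to see that the norm of \<open>((1 + c x\<^sup>2) T\<^sub>i\<^sub>j)\<close> increases with \<open>c \<ge> 0\<close>. By
  convexity it suffices to compare with \<open>c = 0\<close>, and there the claim holds because the multiplier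
  \<open>- x\<^sup>2\<close> is the square of the generator of the group
  \<open>T \<mapsto> diag (exp (\<i> s p)) T diag (exp (- \<i> s q))\<close>, which is isometric.
\<close>

section \<open>Product formulas\<close>

text \<open>Sorting the indices up to \<open>2*n\<close> by parity: even indices give the sine
  factors at \<open>z\<close>, odd ones the cosine factors. This is the finite form of sin 2w = 2
  sin w cos w.\<close>

lemma prod_even_odd_split:
  fixes z :: complex
  shows "(\<Prod>k=1..2*n. 1 - (2*z)\<^sup>2 / of_nat k ^ 2) =
    (\<Prod>k<n. 1 - 4 * z\<^sup>2 / (2 * of_nat k + 1)\<^sup>2) * (\<Prod>k=1..n. 1 - z\<^sup>2 / of_nat k ^ 2)"
proof (induction n)
  case (Suc n)
  have "2 * z / (2 * of_nat n + 2) = 2 * z / (2 * (of_nat n + 1))"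
    by (simp only: distrib_left mult_1_right)
  also have "\<dots> = z / (of_nat n + 1)"
    by (rule mult_divide_mult_cancel_left) simp
  finally have "(2*z)\<^sup>2 / (2 * of_nat n + 2)\<^sup>2 = z\<^sup>2 / (of_nat n + 1)\<^sup>2"
    by (metis power_divide)
  with Suc show ?case
    by (simp add: prod.nat_ivl_Suc' power_mult_distrib add_ac mult_ac)
qed simp

text \<open>Follows from cos w = sin 2w / (2 sin w) by dividing two sine products. The hypothesis
  leaves out the nonzero integers \<open>z\<close>, where this quotient is 0/0.\<close>

lemma cos_product_formula_complex:
  fixes z :: complex
  assumes "z = 0 \<or> sin (of_real pi * z) \<noteq> 0"
  shows "(\<lambda>n. \<Prod>k<n. 1 - 4 * z\<^sup>2 / (2 * of_nat k + 1)\<^sup>2) \<longlonglongrightarrow> cos (of_real pi * z)"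
proof (cases "z = 0")
  case False
  define P where "P w n = of_real pi * w * (\<Prod>k=1..n. 1 - w\<^sup>2 / of_nat k ^ 2)" for w :: complex and n
  have sin_ne: "sin (of_real pi * z) \<noteq> 0"
    using assms False by simp
  have lim: "P w \<longlonglongrightarrow> sin (of_real pi * w)" for w
    unfolding P_def[abs_def] by (rule sin_product_formula_complex)
  have "(\<lambda>n. P (2*z) (2*n)) \<longlonglongrightarrow> sin (of_real pi * (2*z))"
    using lim by (rule filterlim_compose) (auto intro!: filterlim_subseq strict_monoI)
  then have "(\<lambda>n. P (2*z) (2*n) / (2 * P z n)) \<longlonglongrightarrow>
      sin (of_real pi * (2*z)) / (2 * sin (of_real pi * z))"
    using sin_ne by (intro tendsto_intros lim) auto
  moreover have "sin (of_real pi * (2*z)) / (2 * sin (of_real pi * z)) = cos (of_real pi * z)"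
    using sin_double[of "of_real pi * z"] sin_ne by (simp add: mult_ac)
  \<comment> \<open>The partial products \<open>P z n\<close> have a nonzero limit, so they are
    eventually nonzero and can be cancelled.\<close>
  moreover have "\<forall>\<^sub>F n in sequentially. P (2*z) (2*n) / (2 * P z n) =
      (\<Prod>k<n. 1 - 4 * z\<^sup>2 / (2 * of_nat k + 1)\<^sup>2)"
    using tendsto_imp_eventually_ne[OF lim sin_ne]
  proof eventually_elim
    case (elim n)
    then show ?case
      unfolding P_def prod_even_odd_split by simp
  qed
  ultimately show ?thesis
    using tendsto_cong by force
qed simp

lemma cosh_product_formula_real:
  fixes x :: real
  shows "(\<lambda>n. \<Prod>k<n. 1 + x\<^sup>2 * (2 / (pi * (2 * real k + 1)))\<^sup>2) \<longlonglongrightarrow> cosh x"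
proof -
  define z where "z = \<i> * of_real (x / pi)"
  have z: "of_real pi * z = \<i> * of_real x"
    by (simp add: z_def)
  have "z = 0 \<or> sin (of_real pi * z) \<noteq> 0"
    unfolding z sin_eq_0 by (auto simp: z_def complex_eq_iff)
  from cos_product_formula_complex[OF this]
  have "(\<lambda>n. \<Prod>k<n. 1 - 4 * z\<^sup>2 / (2 * of_nat k + 1)\<^sup>2) \<longlonglongrightarrow> of_real (cosh x)"
    unfolding z by (simp add: cosh_field_def exp_minus flip: cosh_real)
  also have "(\<lambda>n. \<Prod>k<n. 1 - 4 * z\<^sup>2 / (2 * of_nat k + 1)\<^sup>2) =
      (\<lambda>n. of_real (\<Prod>k<n. 1 + x\<^sup>2 * (2 / (pi * (2 * real k + 1)))\<^sup>2))"
    by (simp add: z_def power_mult_distrib power_divide mult_ac)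
  finally show ?thesis
    by (simp only: tendsto_of_real_iff)
qed

text \<open>Exhibits cosh y + cos \<phi> as twice the squared modulus of the cosine at (\<phi> +
  iy)/2, so that the complex cosine product yields a product of real factors.\<close>

lemma cmod_cos_squared:
  "(cmod (cos (Complex a b)))\<^sup>2 = (cosh (2*b) + cos (2*a)) / 2"
proof -
  have "(cmod (cos (Complex a b)))\<^sup>2 = (cos a)\<^sup>2 + (sinh b)\<^sup>2"
    by (simp add: norm_cos_squared sinh_field_def exp_minus power_divide)
  moreover have "cosh (2*b) = 1 + 2 * (sinh b)\<^sup>2"
    by (simp add: cosh_double cosh_square_eq)
  moreover have "cos (2*a) = 2 * (cos a)\<^sup>2 - 1"
    by (rule cos_double_cos)
  ultimately show ?thesis
    by simp
qed

lemma cmod_one_minus_square: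
  fixes c :: real
  assumes "c \<noteq> 0"
  shows "(cmod (1 - (Complex a b / of_real c)\<^sup>2))\<^sup>2 =
    ((c - a)\<^sup>2 + b\<^sup>2) * ((c + a)\<^sup>2 + b\<^sup>2) / c ^ 4"
proof -
  have "1 - (Complex a b / of_real c)\<^sup>2 =
      (of_real c - Complex a b) * (of_real c + Complex a b) / of_real (c\<^sup>2)"
    using assms by (simp add: field_simps power2_eq_square)
  then show ?thesis
    by (simp add: norm_mult norm_divide norm_power power_mult_distrib power_divide cmod_power2
        flip: power_mult)
qed

text \<open>The squared modulus of the cosine product at (\<phi> + ix)/2 is divided by its value at
  x = 0. The bound \<phi> < pi keeps \<open>1 + cos \<phi>\<close> and all denominators
  positive.\<close>

lemma cosh_plus_cos_product_formula:
  fixes x \<phi> :: real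
  assumes "0 \<le> \<phi>" "\<phi> < pi"
  shows "(\<lambda>n. \<Prod>k<n. (1 + x\<^sup>2 * (1 / (pi * (2 * real k + 1) - \<phi>))\<^sup>2) *
      (1 + x\<^sup>2 * (1 / (pi * (2 * real k + 1) + \<phi>))\<^sup>2)) \<longlonglongrightarrow> (cosh x + cos \<phi>) / (1 + cos \<phi>)"
    (is "?P \<longlonglongrightarrow> _")
proof -
  define z where "z y = Complex (\<phi> / 2) (y / 2) / of_real pi" for y
  define Q where "Q y n = (\<Prod>k<n. 1 - 4 * (z y)\<^sup>2 / (2 * of_nat k + 1)\<^sup>2)" for y n
  have lim: "(\<lambda>n. (cmod (Q y n))\<^sup>2) \<longlonglongrightarrow> (cosh y + cos \<phi>) / 2" for y
  proof -
    have zpi: "of_real pi * z y = Complex (\<phi> / 2) (y / 2)"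
      by (simp add: z_def)
    \<comment> \<open>A zero of the sine would force \<phi>/2 to be an integer multiple of pi, and 0
      \<le> \<phi> < pi leaves only 0.\<close>
    have "z y = 0 \<or> sin (of_real pi * z y) \<noteq> 0"
    proof (rule disjCI)
      assume "\<not> sin (of_real pi * z y) \<noteq> 0"
      then obtain m :: int where m: "Complex (\<phi> / 2) (y / 2) = of_real (of_int m * pi)"
        unfolding zpi by (auto simp: sin_eq_0)
      then have "\<phi> / 2 = of_int m * pi" and y: "y = 0"
        by (auto simp: complex_eq_iff)
      with assms have "0 \<le> of_int m * pi" "of_int m * pi < 1 * pi"
        by linarith+
      then have "0 \<le> real_of_int m" "real_of_int m < 1"
        using pi_gt_zero by (auto simp: zero_le_mult_iff simp del: pi_gt_zero)
      then have "m = 0" by linarith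
      with m show "z y = 0" by (simp add: z_def)
    qed
    from tendsto_power[OF tendsto_norm[OF cos_product_formula_complex[OF this]], of 2]
    show ?thesis
      unfolding zpi Q_def[symmetric] cmod_cos_squared by simp
  qed
  have cos_gt: "0 < 1 + cos \<phi>"
    using assms cos_monotone_0_pi[of \<phi> pi] by simp
  have Q_eq: "(cmod (Q x n))\<^sup>2 = ?P n * (cmod (Q 0 n))\<^sup>2" for n
  proof -
    have "(cmod (1 - 4 * (z x)\<^sup>2 / (2 * of_nat k + 1)\<^sup>2))\<^sup>2 =
      (1 + x\<^sup>2 * (1 / (pi * (2 * real k + 1) - \<phi>))\<^sup>2) *
      (1 + x\<^sup>2 * (1 / (pi * (2 * real k + 1) + \<phi>))\<^sup>2) *
      (cmod (1 - 4 * (z 0)\<^sup>2 / (2 * of_nat k + 1)\<^sup>2))\<^sup>2" for k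
    proof -
      define c where "c = pi * (2 * real k + 1)"
      have c: "c > \<phi>" "c > 0"
      proof -
        have "pi \<le> c"
          by (simp add: c_def)
        then show "c > \<phi>" "c > 0"
          using assms by linarith+
      qed
      have "4 * (z y)\<^sup>2 / (2 * of_nat k + 1)\<^sup>2 = (Complex \<phi> y / of_real c)\<^sup>2" for y
      proof -
        have "2 * Complex (\<phi> / 2) (y / 2) = Complex \<phi> y"
          by (simp add: complex_eq_iff)
        then have "2 * z y / (2 * of_nat k + 1) = Complex \<phi> y / of_real c"
          unfolding z_def c_def by simp
        then have "(2 * z y / (2 * of_nat k + 1))\<^sup>2 = (Complex \<phi> y / of_real c)\<^sup>2"
          by simp
        then show ?thesis
          by (simp add: power_divide power_mult_distrib)
      qed
      then have norm_eq: "(cmod (1 - 4 * (z y)\<^sup>2 / (2 * of_nat k + 1)\<^sup>2))\<^sup>2 =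
          ((c - \<phi>)\<^sup>2 + y\<^sup>2) * ((c + \<phi>)\<^sup>2 + y\<^sup>2) / c ^ 4" for y
        using cmod_one_minus_square[of c \<phi> y] c by simp
      \<comment> \<open>Pulling out the value at x = 0 leaves exactly the normalised
        factors.\<close>
      have "((c - \<phi>)\<^sup>2 + x\<^sup>2) = (1 + x\<^sup>2 * (1 / (c - \<phi>))\<^sup>2) * (c - \<phi>)\<^sup>2"
        "((c + \<phi>)\<^sup>2 + x\<^sup>2) = (1 + x\<^sup>2 * (1 / (c + \<phi>))\<^sup>2) * (c + \<phi>)\<^sup>2"
        using c assms by (simp_all add: power_divide distrib_right)
      then show ?thesis
        unfolding norm_eq c_def[symmetric] by simp
    qed
    then show ?thesis
      unfolding Q_def by (simp add: prod_norm[symmetric] prod_power_distrib prod.distrib)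
  qed
  have "(\<lambda>n. (cmod (Q x n))\<^sup>2 / (cmod (Q 0 n))\<^sup>2) \<longlonglongrightarrow>
      ((cosh x + cos \<phi>) / 2) / ((cosh 0 + cos \<phi>) / 2)"
    using cos_gt by (intro tendsto_divide lim) auto
  moreover have "\<forall>\<^sub>F n in sequentially. (cmod (Q x n))\<^sup>2 / (cmod (Q 0 n))\<^sup>2 = ?P n"
  proof -
    have "(cosh 0 + cos \<phi>) / 2 \<noteq> 0"
      using cos_gt by simp
    from tendsto_imp_eventually_ne[OF lim this] show ?thesis
      by eventually_elim (simp add: Q_eq)
  qed
  ultimately have "?P \<longlonglongrightarrow> ((cosh x + cos \<phi>) / 2) / ((cosh 0 + cos \<phi>) / 2)"
    by (rule Lim_transform_eventually)
  moreover have "c / 2 / (d / 2) = c / d" for c d :: real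
    by simp
  ultimately show ?thesis
    by (simp only: cosh_0)
qed

text \<open>Concavity: on [0, pi/2] the sine lies above the chord from (0, 0) to (pi/2, 1).\<close>

lemma sin_ge_chord:
  assumes "0 \<le> v" "v \<le> 1"
  shows "v \<le> sin (pi / 2 * v)"
proof -
  have "concave_on {0..pi} sin"
    by (rule f''_le0_imp_concave[where f' = cos and f'' = "\<lambda>x. - sin x"])
      (auto intro!: derivative_eq_intros sin_ge_zero)
  from concave_onD[OF this, of v 0 "pi/2"] assms show ?thesis
    by (simp add: mult.commute)
qed

section \<open>Schur multipliers and unitarily invariant norms\<close>

lemma matrix_normD:
  assumes "matrix_norm N"
  shows "N (r *\<^sub>R T) = \<bar>r\<bar> * N T" "N (S + T) \<le> N S + N T"
proof -
  have "r *\<^sub>R T = map_matrix (\<lambda>z. of_real r * z) T"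
    by (simp add: map_matrix_def vec_eq_iff scaleR_conv_of_real[where 'a = complex])
  then show "N (r *\<^sub>R T) = \<bar>r\<bar> * N T" "N (S + T) \<le> N S + N T"
    using assms unfolding matrix_norm_def by (simp_all del: of_real_mult)
qed

text \<open>A norm is convex, and a convex function on a finite-dimensional space is continuous.
  This lets inequalities between partial products pass to the limit.\<close>

lemma matrix_norm_continuous:
  fixes N :: "complex^'n^'n \<Rightarrow> real"
  assumes "matrix_norm N"
  shows "continuous_on UNIV N"
proof (rule convex_on_continuous)
  show "convex_on UNIV N"
  proof (rule convex_onI)
    fix t :: real and S T :: "complex^'n^'n"
    assume "0 < t" "t < 1"
    then show "N ((1 - t) *\<^sub>R S + t *\<^sub>R T) \<le> (1 - t) * N S + t * N T"
      using matrix_normD(2)[OF assms, of "(1 - t) *\<^sub>R S" "t *\<^sub>R T"]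
      by (simp add: matrix_normD(1)[OF assms])
  qed simp
qed simp

definition schur :: "('n \<Rightarrow> 'n \<Rightarrow> real) \<Rightarrow> complex^'n^'n \<Rightarrow> complex^'n^'n" where
  "schur f T = (\<chi> i j. of_real (f i j) * T $ i $ j)"

lemma schur_schur: "schur f (schur g T) = schur (\<lambda>i j. f i j * g i j) T"
  by (simp add: schur_def mult.assoc)

lemma schur_add: "schur f T + schur g T = schur (\<lambda>i j. f i j + g i j) T"
  by (simp add: schur_def vec_eq_iff algebra_simps)

lemma schur_scaleR: "r *\<^sub>R schur f T = schur (\<lambda>i j. r * f i j) T"
  by (simp add: schur_def vec_eq_iff scaleR_conv_of_real[where 'a = complex] mult.assoc)

text \<open>The bridge from matrix powers to multipliers: in eigenbases, multiplying by powers of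
  \<open>A\<close> on the left and of \<open>B\<close> on the right scales each entry
  separately.\<close>

lemma diag_mult_diag: "real_diag_matrix d ** T ** real_diag_matrix e = schur (\<lambda>i j. d i * e j) T"
  by (simp add: vec_eq_iff diag_mult_left diag_mult_right schur_def mult_ac)

lemma tendsto_norm_schur:
  fixes T :: "complex^'n^'n"
  assumes "matrix_norm N" and "\<And>i j. ((\<lambda>n. f n i j) \<longlongrightarrow> g i j) F"
  shows "((\<lambda>n. N (schur (f n) T)) \<longlongrightarrow> N (schur g T)) F"
proof -
  have "((\<lambda>n. schur (f n) T) \<longlongrightarrow> schur g T) F"
    unfolding schur_def by (intro tendsto_intros assms)
  then show ?thesis
    using matrix_norm_continuous[OF assms(1)]
    by (auto intro: continuous_on_tendsto_compose[where s = UNIV])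
qed

section \<open>Diagonal unitaries and monotonicity in the quadratic coefficient\<close>

definition cis_diag :: "('n \<Rightarrow> real) \<Rightarrow> complex^'n^'n" where
  "cis_diag p = (\<chi> i j. if i = j then cis (p i) else 0)"

lemma cis_diag_mult_left: "(cis_diag p ** T) $ i $ j = cis (p i) * T $ i $ j"
  by (simp add: cis_diag_def matrix_matrix_mult_def if_distrib if_distribR cong: if_cong)

lemma cis_diag_mult_right: "(T ** cis_diag q) $ i $ j = T $ i $ j * cis (q j)"
  by (simp add: cis_diag_def matrix_matrix_mult_def if_distrib cong: if_cong)

lemma cis_diag_mult: "(cis_diag p ** T ** cis_diag q) $ i $ j = cis (p i + q j) * T $ i $ j"
  by (simp add: cis_diag_mult_left cis_diag_mult_right flip: cis_mult)

lemma unitary_cis_diag: "unitary_matrix (cis_diag p)"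
proof -
  have "adjoint_matrix (cis_diag p) = cis_diag (\<lambda>i. - p i)"
    by (simp add: adjoint_matrix_def cis_diag_def map_matrix_def transpose_def vec_eq_iff cis_cnj)
  moreover have "cis_diag r ** cis_diag s = mat 1" if "\<And>i. r i + s i = 0" for r s :: "'a \<Rightarrow> real"
    using that by (simp add: vec_eq_iff cis_diag_mult_left) (simp add: cis_diag_def mat_def cis_mult)
  ultimately show ?thesis
    by (simp add: unitary_matrix_def)
qed

text \<open>Second differences along the isometric group replace the square of its generator. For
  each step size \<open>s\<close> the triangle inequality gives the bound, and \<open>s\<close> then
  tends to 0.\<close>

lemma norm_le_norm_schur_quadratic:
  fixes N :: "complex^'n^'n \<Rightarrow> real"
  assumes N: "unitarily_invariant_norm N" and c: "0 \<le> c"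
  shows "N T \<le> N (schur (\<lambda>i j. 1 + c * (p i - q j)\<^sup>2) T)"
proof -
  have norm: "matrix_norm N"
    using N by (simp add: unitarily_invariant_norm_def)
  define U where "U s = cis_diag (\<lambda>i. s * p i) ** T ** cis_diag (\<lambda>j. - (s * q j))" for s
  have NU: "N (U s) = N T" for s
    using N unitary_cis_diag unfolding U_def unitarily_invariant_norm_def by blast
  \<comment> \<open>\<open>((p i - q j)\<^sup>2 T i j)\<close> is the limit of \<open>(2 T - U s - U (- s)) / s\<^sup>2\<close>, and \<open>U s\<close>, \<open>U (- s)\<close> have the same norm as \<open>T\<close>.\<close>
  define f where "f s i j = 1 + c * ((2 - 2 * cos (s * (p i - q j))) / s\<^sup>2)" for s i j
  have "N T \<le> N (schur (f s) T)" if "s \<noteq> 0" for s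
  proof -
    define a where "a = c / s\<^sup>2"
    have a: "a \<ge> 0"
      using c by (simp add: a_def)
    have cc: "cis x + cis (- x) = of_real (2 * cos x)" for x
      by (simp add: complex_eq_iff)
    have e: "(U s + U (- s)) $ i $ j = of_real (2 * cos (s * (p i - q j))) * T $ i $ j" for i j
    proof -
      have "(U s + U (- s)) $ i $ j = (cis (s * (p i - q j)) + cis (- (s * (p i - q j)))) * T $ i $ j"
        by (simp add: U_def cis_diag_mult algebra_simps)
      then show ?thesis
        by (simp only: cc)
    qed
    \<comment> \<open>The weight \<open>1 + 2 * a\<close> of \<open>T\<close> exceeds by 1 the total
      weight of the two isometric images, so the triangle inequality leaves \<open>N T\<close> once
      their norms cancel.\<close>
    have "(1 + 2 * a) *\<^sub>R T = schur (f s) T + a *\<^sub>R (U s + U (- s))"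
      unfolding vec_eq_iff vector_add_component vector_scaleR_component
      using e by (simp add: schur_def f_def a_def scaleR_conv_of_real[where 'a = complex] diff_divide_distrib algebra_simps)
    then have "(1 + 2 * a) * N T = N (schur (f s) T + a *\<^sub>R (U s + U (- s)))"
      using a matrix_normD(1)[OF norm, of "1 + 2 * a" T] by simp
    also have "\<dots> \<le> N (schur (f s) T) + a * (N (U s) + N (U (- s)))"
      using a matrix_normD(2)[OF norm, of "U s" "U (- s)"]
        matrix_normD(2)[OF norm, of "schur (f s) T" "a *\<^sub>R (U s + U (- s))"]
        mult_left_mono[of "N (U s + U (- s))" "N (U s) + N (U (- s))" a]
      by (simp add: matrix_normD(1)[OF norm])
    finally show ?thesis
      by (simp add: NU algebra_simps)
  qed
  then have "\<forall>\<^sub>F s in at 0. N T \<le> N (schur (f s) T)"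
    by (simp add: eventually_at_filter)
  moreover have "((\<lambda>s. N (schur (f s) T)) \<longlongrightarrow> N (schur (\<lambda>i j. 1 + c * (p i - q j)\<^sup>2) T)) (at 0)"
  proof (rule tendsto_norm_schur[OF norm])
    fix i j
    show "((\<lambda>s. f s i j) \<longlongrightarrow> 1 + c * (p i - q j)\<^sup>2) (at 0)"
    proof -
      define x where "x = p i - q j"
      \<comment> \<open>By the half-angle formula, the quotient in \<open>f\<close> is the square of
        a difference quotient of 2 sin(sx/2), whose derivative at 0 is x.\<close>
      have "((\<lambda>s. 2 * sin (s * (x / 2))) has_field_derivative x) (at 0)"
        by (auto intro!: derivative_eq_intros)
      then have lim: "((\<lambda>s. 2 * sin (s * (x / 2)) / s) \<longlongrightarrow> x) (at 0)"
        by (simp add: DERIV_def)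
      have "2 - 2 * cos (s * x) = (2 * sin (s * (x / 2)))\<^sup>2" for s
        using cos_double_sin[of "s * (x / 2)"] by (simp add: power_mult_distrib)
      then have "f s i j = 1 + c * (2 * sin (s * (x / 2)) / s)\<^sup>2" for s
        by (simp add: f_def x_def power_divide)
      then show ?thesis
        unfolding x_def[symmetric] by (simp only:) (intro tendsto_intros lim)
    qed
  qed
  ultimately show ?thesis
    by (intro tendsto_lowerbound) auto
qed

text \<open>With t = a/b, the multiplier for \<open>a\<close> is the convex combination of 1 and the
  multiplier for \<open>b\<close>, and the norm with multiplier 1 is the smaller one.\<close>

lemma norm_schur_quadratic_mono:
  fixes N :: "complex^'n^'n \<Rightarrow> real"
  assumes N: "unitarily_invariant_norm N" and ab: "0 \<le> a" "a \<le> b"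
  shows "N (schur (\<lambda>i j. 1 + a * (p i - q j)\<^sup>2) T) \<le> N (schur (\<lambda>i j. 1 + b * (p i - q j)\<^sup>2) T)"
proof (cases "b = 0")
  case False
  with ab have b: "b > 0" by simp
  have norm: "matrix_norm N"
    using N by (simp add: unitarily_invariant_norm_def)
  define t where "t = a / b"
  have t: "0 \<le> t" "t \<le> 1" "a = t * b"
    using ab b by (simp_all add: t_def)
  let ?S = "schur (\<lambda>i j. 1 + b * (p i - q j)\<^sup>2) T"
  have "schur (\<lambda>i j. 1 + a * (p i - q j)\<^sup>2) T = (1 - t) *\<^sub>R T + t *\<^sub>R ?S"
    by (simp add: t(3) vec_eq_iff schur_def scaleR_conv_of_real[where 'a = complex] algebra_simps)
  then have "N (schur (\<lambda>i j. 1 + a * (p i - q j)\<^sup>2) T) \<le> (1 - t) * N T + t * N ?S"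
    using matrix_normD(2)[OF norm, of "(1 - t) *\<^sub>R T" "t *\<^sub>R ?S"] t
    by (simp add: matrix_normD(1)[OF norm])
  also have "\<dots> \<le> (1 - t) * N ?S + t * N ?S"
    using t b norm_le_norm_schur_quadratic[OF N, of b T p q]
    by (intro add_right_mono mult_left_mono) auto
  finally show ?thesis
    by (simp add: algebra_simps)
qed (use ab in simp)

text \<open>The factors are exchanged one at a time. \<open>T\<close> is arbitrary in the induction
  so that it can absorb the last factor; since multipliers commute, that factor can then be moved
  outermost and enlarged.\<close>

lemma norm_schur_prod_mono:
  fixes N :: "complex^'n^'n \<Rightarrow> real" and a b :: "nat \<Rightarrow> real"
  assumes N: "unitarily_invariant_norm N" and ab: "\<And>k. 0 \<le> a k" "\<And>k. a k \<le> b k"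
  shows "N (schur (\<lambda>i j. \<Prod>k<n. 1 + a k * (p i - q j)\<^sup>2) T)
       \<le> N (schur (\<lambda>i j. \<Prod>k<n. 1 + b k * (p i - q j)\<^sup>2) T)"
proof (induction n arbitrary: T)
  case (Suc n)
  define D where "D c = schur (\<lambda>i j. 1 + c * (p i - q j)\<^sup>2)" for c
  have step: "schur (\<lambda>i j. \<Prod>k<Suc n. 1 + c k * (p i - q j)\<^sup>2) T =
      schur (\<lambda>i j. \<Prod>k<n. 1 + c k * (p i - q j)\<^sup>2) (D (c n) T)"
    "schur (\<lambda>i j. \<Prod>k<n. 1 + c k * (p i - q j)\<^sup>2) (D e T) =
      D e (schur (\<lambda>i j. \<Prod>k<n. 1 + c k * (p i - q j)\<^sup>2) T)" for c e T
    by (simp_all add: D_def schur_schur mult_ac)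
  have "N (schur (\<lambda>i j. \<Prod>k<n. 1 + a k * (p i - q j)\<^sup>2) (D (a n) T))
      \<le> N (schur (\<lambda>i j. \<Prod>k<n. 1 + b k * (p i - q j)\<^sup>2) (D (a n) T))"
    by (rule Suc)
  also have "\<dots> \<le> N (schur (\<lambda>i j. \<Prod>k<n. 1 + b k * (p i - q j)\<^sup>2) (D (b n) T))"
    unfolding step(2) unfolding D_def
    by (rule norm_schur_quadratic_mono[OF N ab])
  finally show ?case
    by (simp only: step(1))
qed simp

section \<open>The spectral theorem for Hermitian matrices\<close>

text \<open>A maximiser \<open>v\<close> of the quadratic form on the unit sphere of
  \<open>W\<close> is an eigenvector: otherwise moving along the residual
  \<open>f v - c *\<^sub>R v\<close>, which stays in \<open>W\<close> by invariance, would increase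
  the Rayleigh quotient to first order.\<close>

lemma selfadjoint_eigenvector:
  fixes f :: "'a::euclidean_space \<Rightarrow> 'a"
  assumes f: "linear f" and sym: "\<And>x y. x \<bullet> f y = f x \<bullet> y"
    and W: "subspace W" "f ` W \<subseteq> W" "W \<noteq> {0}"
  obtains v c where "v \<in> W" "norm v = 1" "f v = c *\<^sub>R v"
proof -
  obtain w0 where w0: "w0 \<in> W" "w0 \<noteq> 0"
    using W subspace_0 by blast
  have "compact (W \<inter> sphere 0 1)"
    by (simp add: W closed_subspace closed_Int_compact)
  moreover have "inverse (norm w0) *\<^sub>R w0 \<in> W \<inter> sphere 0 1"
    using w0 W by (simp add: subspace_scale)
  moreover have "continuous_on (W \<inter> sphere 0 1) (\<lambda>x. x \<bullet> f x)"
    using f by (intro continuous_on_inner continuous_on_id linear_continuous_on)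
      (simp add: linear_conv_bounded_linear)
  ultimately have "\<exists>v\<in>W \<inter> sphere 0 1. \<forall>x\<in>W \<inter> sphere 0 1. x \<bullet> f x \<le> v \<bullet> f v"
    by (intro continuous_attains_sup) blast+
  then obtain v where v: "v \<in> W" "norm v = 1"
    and max: "\<And>x. x \<in> W \<Longrightarrow> norm x = 1 \<Longrightarrow> x \<bullet> f x \<le> v \<bullet> f v"
    by auto
  define c where "c = v \<bullet> f v"
  have bound: "x \<bullet> f x \<le> c * (x \<bullet> x)" if "x \<in> W" for x
  proof (cases "x = 0")
    case False
    have "(inverse (norm x) *\<^sub>R x) \<bullet> f (inverse (norm x) *\<^sub>R x) \<le> c"
      unfolding c_def using that False W(1) by (intro max) (simp_all add: subspace_scale)
    then have "x \<bullet> f x / (norm x)\<^sup>2 \<le> c"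
      by (simp add: linear_scale[OF f] power2_eq_square field_simps)
    then show ?thesis
      using False by (simp add: divide_le_eq power2_norm_eq_inner)
  qed (simp add: linear_0[OF f])
  define w where "w = f v - c *\<^sub>R v"
  have w: "w \<in> W"
    using v W unfolding w_def by (blast intro: subspace_diff subspace_scale)
  define C where "C = c * (w \<bullet> w) - w \<bullet> f w"
  have ineq: "2 * t * (w \<bullet> w) \<le> t\<^sup>2 * C" for t
  proof -
    have "(v + t *\<^sub>R w) \<bullet> f (v + t *\<^sub>R w) \<le> c * ((v + t *\<^sub>R w) \<bullet> (v + t *\<^sub>R w))"
      using v w W by (intro bound) (simp add: subspace_add subspace_scale)
    moreover have "(v + t *\<^sub>R w) \<bullet> f (v + t *\<^sub>R w) = c + 2 * t * (w \<bullet> f v) + t\<^sup>2 * (w \<bullet> f w)"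
      using sym[of v w]
      by (simp add: linear_add[OF f] linear_scale[OF f] inner_add_left inner_add_right c_def
          inner_commute power2_eq_square algebra_simps)
    moreover have "(v + t *\<^sub>R w) \<bullet> (v + t *\<^sub>R w) = 1 + 2 * t * (w \<bullet> v) + t\<^sup>2 * (w \<bullet> w)"
      using v by (simp only: inner_add_left inner_add_right inner_scaleR_left inner_scaleR_right
          inner_commute[of v w] dot_square_norm[of v]) (simp add: power2_eq_square algebra_simps)
    ultimately have "c + 2 * t * (w \<bullet> f v) + t\<^sup>2 * (w \<bullet> f w) \<le>
        c * (1 + 2 * t * (w \<bullet> v) + t\<^sup>2 * (w \<bullet> w))"
      by simp
    then have "2 * t * (w \<bullet> f v - c * (w \<bullet> v)) \<le> t\<^sup>2 * C"
      by (simp add: C_def algebra_simps)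
    moreover have "w \<bullet> w = w \<bullet> f v - c * (w \<bullet> v)"
      by (metis inner_diff_right inner_scaleR_right w_def)
    ultimately show ?thesis
      by simp
  qed
  have "w \<bullet> w = 0"
  proof (rule ccontr)
    assume "w \<bullet> w \<noteq> 0"
    then have pos: "w \<bullet> w > 0"
      using inner_ge_zero[of w] by linarith
    \<comment> \<open>Small enough for the second-order term to lose against the first-order one;
      the summand 1 keeps the denominator positive even if \<open>C = 0\<close>.\<close>
    define t where "t = (w \<bullet> w) / (\<bar>C\<bar> + 1)"
    have "t > 0" "t * C \<le> w \<bullet> w"
      using pos by (auto simp: t_def field_simps abs_if)
    then have "t\<^sup>2 * C \<le> t * (w \<bullet> w)"
      by (simp add: power2_eq_square mult.assoc)
    moreover have "0 < t * (w \<bullet> w)"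
      using \<open>t > 0\<close> pos by (rule mult_pos_pos)
    ultimately show False
      using ineq[of t] by simp
  qed
  then have "f v = c *\<^sub>R v"
    by (simp add: w_def)
  with v show thesis by (rule that)
qed

text \<open>The Hermitian form, conjugate-linear in the first argument. Its real part is the
  Euclidean inner product of \<open>complex^'n\<close> as a real space, so real results
  apply.\<close>

definition cinner :: "complex^'n \<Rightarrow> complex^'n \<Rightarrow> complex" where
  "cinner x y = (\<Sum>i\<in>UNIV. cnj (x $ i) * y $ i)"

lemma inner_eq_Re_cinner: "x \<bullet> y = Re (cinner x y)"
  by (simp add: cinner_def inner_vec_def inner_complex_def)

lemma cinner_simps:
  "cinner x (y + z) = cinner x y + cinner x z" "cinner x (r *\<^sub>R y) = of_real r * cinner x y"
  "cinner x (a *s y) = a * cinner x y" "cinner (a *s x) y = cnj a * cinner x y"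
  "cinner x 0 = 0" "cnj (cinner x y) = cinner y x"
  by (simp_all add: cinner_def sum.distrib sum_distrib_left scaleR_conv_of_real[where 'a = complex]
      algebra_simps)

lemma cinner_self: "cinner x x = of_real ((norm x)\<^sup>2)"
proof -
  have "Im (cinner x x) = 0"
    by (simp add: cinner_def mult.commute)
  then show ?thesis
    by (simp add: complex_eq_iff flip: inner_eq_Re_cinner power2_norm_eq_inner)
qed

lemma cinner_matrix_vector:
  "cinner x (A *v y) = cinner (adjoint_matrix A *v x) y"
  unfolding cinner_def matrix_vector_mult_def adjoint_matrix_def
  by (simp add: map_matrix_def transpose_def sum_distrib_left sum_distrib_right mult_ac)
    (rule sum.swap)

definition orthonormal_eigenvectors :: "complex^'n^'n \<Rightarrow> (complex^'n) set \<Rightarrow> bool" where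
  "orthonormal_eigenvectors A S \<longleftrightarrow>
     (\<forall>u\<in>S. \<forall>v\<in>S. cinner u v = (if u = v then 1 else 0)) \<and>
     (\<forall>u\<in>S. \<exists>c::real. A *v u = c *\<^sub>R u)"

lemma linear_matrix_vector: "linear ((*v) (A :: complex^'n^'m))"
  by (rule linearI) (simp_all add: matrix_vector_mult_def vec_eq_iff algebra_simps sum.distrib
      scaleR_sum_right)

text \<open>The complex orthogonal complement of \<open>S\<close> is a nonzero real subspace. It is
  invariant because \<open>A\<close> is Hermitian and \<open>S\<close> consists of eigenvectors, so
  it contains a unit eigenvector.\<close>

lemma exists_orthogonal_eigenvector:
  fixes A :: "complex^'n^'n"
  assumes A: "adjoint_matrix A = A" and S: "orthonormal_eigenvectors A S"
    and y: "y \<noteq> 0" "\<And>u. u \<in> S \<Longrightarrow> cinner u y = 0"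
  obtains v where "v \<notin> S" "orthonormal_eigenvectors A (insert v S)"
proof -
  define W where "W = {x. \<forall>u\<in>S. cinner u x = 0}"
  have "subspace W"
    by (auto simp: subspace_def W_def cinner_simps)
  moreover have "(*v) A ` W \<subseteq> W"
    using S unfolding W_def orthonormal_eigenvectors_def
    by (auto simp: cinner_matrix_vector A) (metis cinner_simps(2,6) complex_cnj_zero mult_zero_right)
  moreover have "W \<noteq> {0}"
    using y by (auto simp: W_def)
  moreover have "x \<bullet> (A *v z) = (A *v x) \<bullet> z" for x z
    by (simp add: inner_eq_Re_cinner cinner_matrix_vector A)
  ultimately obtain v c where v: "v \<in> W" "norm v = 1" "A *v v = c *\<^sub>R v"
    using selfadjoint_eigenvector[OF linear_matrix_vector] by metis
  have vv: "cinner v v = 1"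
    using v by (simp add: cinner_self)
  have "v \<notin> S"
    using v(1) vv by (auto simp: W_def)
  moreover have "cinner u v = 0" "cinner v u = 0" if "u \<in> S" for u
    using v(1) that cinner_simps(6)[of u v] by (auto simp: W_def)
  ultimately have "orthonormal_eigenvectors A (insert v S)"
    using S v(3) vv unfolding orthonormal_eigenvectors_def by auto
  with \<open>v \<notin> S\<close> show thesis
    by (rule that)
qed

text \<open>Passes from complex to real dimension: \<open>S\<close> and its multiple by \<i> are
  disjoint and together orthogonal for the real inner product. As the real dimension is twice
  \<open>CARD('n)\<close>, this bounds \<open>card S\<close> by \<open>CARD('n)\<close>.\<close>

lemma orthonormal_eigenvectors_independent:
  fixes A :: "complex^'n^'n"
  assumes S: "orthonormal_eigenvectors A S"
  defines "T \<equiv> S \<union> (*s) \<i> ` S"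
  shows "independent T" "card T = 2 * card S"
proof -
  have ort: "cinner u v = (if u = v then 1 else 0)" if "u \<in> S" "v \<in> S" for u v
    using S that by (auto simp: orthonormal_eigenvectors_def)
  have "x \<bullet> y = 0" if "x \<in> T" "y \<in> T" "x \<noteq> y" for x y
    using that unfolding T_def by (auto simp: inner_eq_Re_cinner cinner_simps ort)
  moreover have "u \<noteq> 0" if "u \<in> S" for u
    using ort[OF that that] by (auto simp: cinner_simps)
  then have "0 \<notin> T"
    by (force simp: T_def vec_eq_iff)
  ultimately show ind: "independent T"
    by (intro pairwise_orthogonal_independent) (auto simp: pairwise_def orthogonal_def)
  then have fin: "finite S"
    using independent_imp_finite unfolding T_def by blast
  have "\<i> *s u \<noteq> v" if "u \<in> S" "v \<in> S" for u v
  proof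
    assume "\<i> *s u = v"
    then have "cinner u v = \<i>"
      using ort[OF that(1,1)] by (auto simp: cinner_simps)
    then show False
      using ort[OF that] by (auto simp: complex_eq_iff split: if_splits)
  qed
  then have "S \<inter> (*s) \<i> ` S = {}"
    by blast
  moreover have "inj_on ((*s) \<i>) S"
    by (auto simp: inj_on_def vec_eq_iff)
  ultimately show "card T = 2 * card S"
    by (simp add: T_def card_Un_disjoint fin card_image)
qed

text \<open>An orthonormal set of eigenvectors of maximal size has \<open>CARD('n)\<close> elements,
  since otherwise a vector orthogonal to it would allow an extension. Its members become the columns
  of \<open>U\<close>.\<close>

theorem hermitian_spectral:
  fixes A :: "complex^'n^'n"
  assumes A: "adjoint_matrix A = A"
  obtains U and d :: "'n \<Rightarrow> real"
  where "unitary_matrix U" "A = U ** real_diag_matrix d ** adjoint_matrix U"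
proof -
  have DIM: "DIM(complex^'n) = 2 * CARD('n)"
    by simp
  have bound: "card S \<le> CARD('n)" if "orthonormal_eigenvectors A S" for S
    using orthonormal_eigenvectors_independent(2)[OF that] DIM
      independent_bound[OF orthonormal_eigenvectors_independent(1)[OF that]] by linarith
  have "orthonormal_eigenvectors A {}"
    by (simp add: orthonormal_eigenvectors_def)
  moreover have "\<forall>S. orthonormal_eigenvectors A S \<longrightarrow> card S < Suc CARD('n)"
    using bound by (simp add: less_Suc_eq_le)
  ultimately obtain S where S: "orthonormal_eigenvectors A S"
    and max: "\<And>S'. orthonormal_eigenvectors A S' \<Longrightarrow> card S' \<le> card S"
    using Lattices_Big.ex_has_greatest_nat[of "orthonormal_eigenvectors A" "{}" card] by blast
  define T where "T = S \<union> (*s) \<i> ` S"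
  have ind: "independent T" and cardT: "card T = 2 * card S"
    unfolding T_def using orthonormal_eigenvectors_independent[OF S] by auto
  have finS: "finite S"
    using independent_imp_finite[OF ind] by (simp add: T_def)
  have "dim T = DIM(complex^'n)"
  proof (rule ccontr)
    assume "dim T \<noteq> DIM(complex^'n)"
    then have "dim T < DIM(complex^'n)"
      using dim_subset_UNIV[of T] by simp
    then obtain y where y: "y \<noteq> 0" "\<And>x. x \<in> span T \<Longrightarrow> orthogonal y x"
      using orthogonal_to_subspace_exists by blast
    \<comment> \<open>Real orthogonality to \<open>u\<close> and to \<open>\<i> *s u\<close> makes
      the real and the imaginary part vanish.\<close>
    have "cinner u y = 0" if "u \<in> S" for u
    proof -
      have "u \<bullet> y = 0" "(\<i> *s u) \<bullet> y = 0"
        using y(2)[of u] y(2)[of "\<i> *s u"] that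
        by (auto simp: T_def span_base orthogonal_def inner_commute)
      then show ?thesis
        by (simp add: inner_eq_Re_cinner cinner_simps complex_eq_iff)
    qed
    then obtain v where "v \<notin> S" "orthonormal_eigenvectors A (insert v S)"
      using exists_orthogonal_eigenvector[OF A S y(1)] by blast
    with max[of "insert v S"] finS show False
      by simp
  qed
  then have "card S = CARD('n)"
    using cardT dim_eq_card_independent[OF ind] DIM by simp
  then obtain h where h: "bij_betw h (UNIV :: 'n set) S"
    using finite_same_card_bij[of "UNIV :: 'n set" S] finS by auto
  have ort: "cinner (h i) (h j) = (if i = j then 1 else 0)" for i j
    using S bij_betw_apply[OF h] bij_betw_imp_inj_on[OF h]
    by (auto simp: orthonormal_eigenvectors_def inj_on_def)
  have "\<forall>j. \<exists>c::real. A *v h j = c *\<^sub>R h j"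
    using S bij_betw_apply[OF h] by (simp add: orthonormal_eigenvectors_def)
  then obtain d :: "'n \<Rightarrow> real" where d: "\<And>j. A *v h j = d j *\<^sub>R h j"
    by metis
  define U :: "complex^'n^'n" where "U = (\<chi> i j. h j $ i)"
  have "(adjoint_matrix U ** U) $ i $ j = cinner (h i) (h j)" for i j
    by (simp add: matrix_matrix_mult_def adjoint_matrix_def map_matrix_def transpose_def U_def
        cinner_def)
  then have "adjoint_matrix U ** U = mat 1"
    by (simp add: vec_eq_iff mat_def ort)
  then have U: "unitary_matrix U"
    using matrix_left_right_inverse[of "adjoint_matrix U" U] by (simp add: unitary_matrix_def)
  have "(A ** U) $ i $ j = (A *v h j) $ i" for i j
    by (simp add: matrix_matrix_mult_def matrix_vector_mult_def U_def)
  then have "A ** U = U ** real_diag_matrix d"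
    by (simp add: vec_eq_iff diag_mult_right d U_def scaleR_conv_of_real[where 'a = complex] mult.commute)
  then have "A = U ** real_diag_matrix d ** adjoint_matrix U"
    using U unfolding unitary_matrix_def by (metis matrix_mul_assoc matrix_mul_rid)
  with U show thesis
    by (rule that)
qed

text \<open>Each eigenvalue \<open>d i\<close> is the value of the positive form at the
  \<open>i\<close>-th column of \<open>U\<close>.\<close>

lemma positive_definite_spectral:
  fixes A :: "complex^'n^'n"
  assumes A: "positive_definite_matrix A"
  obtains U and d :: "'n \<Rightarrow> real"
  where "unitary_matrix U" "\<And>i. 0 < d i" "A = U ** real_diag_matrix d ** adjoint_matrix U"
proof -
  have herm: "adjoint_matrix A = A"
    and pos: "\<And>x. x \<noteq> 0 \<Longrightarrow> 0 < Re (cinner x (A *v x))"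
    using A by (auto simp: positive_definite_matrix_def cinner_def)
  obtain U d where U: "unitary_matrix U" and eq: "A = U ** real_diag_matrix d ** adjoint_matrix U"
    using hermitian_spectral[OF herm] .
  have "0 < d i" for i
  proof -
    define x where "x = U *v axis i 1"
    have img: "adjoint_matrix U *v x = axis i 1"
      using U by (simp add: x_def unitary_matrix_def matrix_vector_mul_assoc)
    then have "x \<noteq> 0"
      by (metis axis_eq_0_iff matrix_vector_mult_0_right one_neq_zero)
    have "A *v x = U *v (real_diag_matrix d *v axis i 1)"
      unfolding eq using img by (simp flip: matrix_vector_mul_assoc)
    then have "cinner x (A *v x) = cinner (axis i 1) (real_diag_matrix d *v axis i 1)"
      by (simp add: cinner_matrix_vector img)
    also have "\<dots> = (real_diag_matrix d *v axis i 1) $ i"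
    proof -
      have "cnj (axis i 1 $ k) * y $ k = (if k = i then y $ k else 0)" for k and y :: "complex^'n"
        by (simp add: axis_def)
      then show ?thesis
        by (simp add: cinner_def)
    qed
    also have "\<dots> = of_real (d i)"
    proof -
      have "real_diag_matrix d $ i $ k * axis i 1 $ k = (if k = i then of_real (d i) else 0)" for k
        by (simp add: axis_def real_diag_matrix_def)
      then show ?thesis
        by (simp add: matrix_vector_mult_def)
    qed
    finally show ?thesis
      using pos[OF \<open>x \<noteq> 0\<close>] by simp
  qed
  with U eq show thesis
    using that by blast
qed

section \<open>Comparison of the multipliers\<close>

lemma prod_even_odd_pairs: "(\<Prod>k<2 * n. f k) = (\<Prod>k<n. f (2 * k) * f (2 * k + 1 :: nat) :: real)"
  by (induction n) (simp_all add: mult.assoc)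

text \<open>The two product expansions are compared factor by factor. At even indices the remainder
  is controlled by the bound on \<open>\<mu> * (pi - \<phi>)\<close>, at odd ones by \<mu> \<le> 1
  and \<phi> \<le> pi/2.\<close>

lemma norm_schur_cosh_le:
  fixes N :: "complex^'n^'n \<Rightarrow> real"
  assumes N: "unitarily_invariant_norm N"
    and \<phi>: "0 \<le> \<phi>" "\<phi> \<le> pi / 2" and \<mu>: "0 \<le> \<mu>" "\<mu> \<le> 1" "\<mu> * (pi - \<phi>) \<le> pi / 2"
  shows "N (schur (\<lambda>i j. cosh (\<mu> * (p i - q j))) T)
       \<le> N (schur (\<lambda>i j. (cosh (p i - q j) + cos \<phi>) / (1 + cos \<phi>)) T)"
proof -
  have norm: "matrix_norm N"
    using N by (simp add: unitarily_invariant_norm_def)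
  define a where "a k = (2 * \<mu> / (pi * (2 * real k + 1)))\<^sup>2" for k
  \<comment> \<open>Interleaves the two families of zeros. Index 2m gives pi(2m+1) - \<phi> and
    index 2m+1 gives pi(2m+1) + \<phi>, hence \<open>real k + 1\<close> in one case and
    \<open>real k\<close> in the other.\<close>
  define b where "b k = (if even k then 1 / (pi * (real k + 1) - \<phi>) else 1 / (pi * real k + \<phi>))\<^sup>2" for k
  have ab: "a k \<le> b k" for k
  proof -
    have pos: "0 < pi * (2 * real k + 1)"
      by simp
    have \<mu>k: "\<mu> * (pi * real k) \<le> pi * real k"
      using \<mu>(2) by (simp add: mult_left_le_one_le \<mu>(1))
    have "2 * \<mu> / (pi * (2 * real k + 1)) \<le>
        (if even k then 1 / (pi * (real k + 1) - \<phi>) else 1 / (pi * real k + \<phi>))"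
    proof (cases "even k")
      case True
      have "0 \<le> pi * real k"
        by simp
      then have "0 < pi * (real k + 1) - \<phi>"
        using \<phi>(2) pi_gt_zero unfolding distrib_left by linarith
      moreover have "2 * \<mu> * (pi * (real k + 1) - \<phi>) \<le> pi * (2 * real k + 1)"
      proof -
        have "2 * \<mu> * (pi * (real k + 1) - \<phi>) = 2 * (\<mu> * (pi * real k)) + 2 * (\<mu> * (pi - \<phi>))"
          "pi * (2 * real k + 1) = 2 * (pi * real k) + pi"
          by (simp_all add: algebra_simps)
        then show ?thesis
          using \<mu>k \<mu>(3) by linarith
      qed
      ultimately show ?thesis
        using True pos by (simp add: divide_le_eq le_divide_eq mult_ac)
    next
      case False
      then have "0 < pi * real k"
        by (simp add: odd_pos)
      then have "0 < pi * real k + \<phi>"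
        using \<phi>(1) by linarith
      have "\<mu> * \<phi> \<le> pi / 2"
        using mult_mono[of \<mu> 1 \<phi> "pi / 2"] \<mu> \<phi> by simp
      have "2 * \<mu> * (pi * real k + \<phi>) \<le> pi * (2 * real k + 1)"
      proof -
        have "2 * \<mu> * (pi * real k + \<phi>) = 2 * (\<mu> * (pi * real k)) + 2 * (\<mu> * \<phi>)"
          "pi * (2 * real k + 1) = 2 * (pi * real k) + pi"
          by (simp_all add: algebra_simps)
        then show ?thesis
          using \<mu>k \<open>\<mu> * \<phi> \<le> pi / 2\<close> by linarith
      qed
      with \<open>0 < pi * real k + \<phi>\<close> show ?thesis
        using False pos by (simp add: divide_le_eq le_divide_eq mult_ac)
    qed
    then show ?thesis
      unfolding a_def b_def using \<mu>(1) by (intro power_mono) simp_all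
  qed
  \<comment> \<open>An even number of factors, because those on the right come in pairs.\<close>
  have le: "N (schur (\<lambda>i j. \<Prod>k<2*n. 1 + a k * (p i - q j)\<^sup>2) T)
      \<le> N (schur (\<lambda>i j. \<Prod>k<2*n. 1 + b k * (p i - q j)\<^sup>2) T)" for n
    using ab by (intro norm_schur_prod_mono[OF N]) (simp_all add: a_def)
  have "(\<lambda>n. \<Prod>k<2*n. 1 + a k * x\<^sup>2) \<longlonglongrightarrow> cosh (\<mu> * x)" for x
  proof -
    have "(\<lambda>n. \<Prod>k<n. 1 + a k * x\<^sup>2) \<longlonglongrightarrow> cosh (\<mu> * x)"
      using cosh_product_formula_real[of "\<mu> * x"]
      by (simp add: a_def power_mult_distrib power_divide mult_ac)
    then show ?thesis
      by (rule filterlim_compose) (auto intro!: filterlim_subseq strict_monoI)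
  qed
  then have lim_a: "(\<lambda>n. N (schur (\<lambda>i j. \<Prod>k<2*n. 1 + a k * (p i - q j)\<^sup>2) T)) \<longlonglongrightarrow>
      N (schur (\<lambda>i j. cosh (\<mu> * (p i - q j))) T)"
    by (intro tendsto_norm_schur[OF norm])
  have "(\<lambda>n. \<Prod>k<2*n. 1 + b k * x\<^sup>2) \<longlonglongrightarrow> (cosh x + cos \<phi>) / (1 + cos \<phi>)" for x
    using cosh_plus_cos_product_formula[of \<phi> x] \<phi> pi_gt_zero unfolding prod_even_odd_pairs
    by (simp add: b_def mult_ac add_ac)
  then have lim_b: "(\<lambda>n. N (schur (\<lambda>i j. \<Prod>k<2*n. 1 + b k * (p i - q j)\<^sup>2) T)) \<longlonglongrightarrow>
      N (schur (\<lambda>i j. (cosh (p i - q j) + cos \<phi>) / (1 + cos \<phi>)) T)"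
    by (intro tendsto_norm_schur[OF norm])
  show ?thesis
    using LIMSEQ_le[OF lim_a lim_b] le by blast
qed

text \<open>
  The bound \<open>\<mu> * (pi - \<phi>) \<le> pi / 2\<close> says that the smallest zero \<open>\<i> * (pi - \<phi>)\<close> of \<open>cosh x + cos \<phi>\<close> is not
  larger in modulus than the smallest zero of \<open>cosh (\<mu> * x)\<close>.
\<close>

lemma exists_angle:
  fixes \<mu> :: real
  assumes "0 \<le> \<mu>" "\<mu> \<le> 1"
  defines "\<rho> \<equiv> min \<mu> (1 - \<mu>)"
  obtains \<phi> where "0 \<le> \<phi>" "\<phi> \<le> pi / 2" "\<mu> * (pi - \<phi>) \<le> pi / 2" "\<rho> = (1 - \<rho>) * cos \<phi>"
proof -
  define c where "c = \<rho> / (1 - \<rho>)"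
  have \<rho>: "0 \<le> \<rho>" "\<rho> \<le> 1 / 2"
    using assms by (auto simp: \<rho>_def min_def)
  then have c: "0 \<le> c" "c \<le> 1" "\<rho> = (1 - \<rho>) * c"
    by (simp_all add: c_def)
  define \<phi> where "\<phi> = arccos c"
  have \<phi>: "0 \<le> \<phi>" "\<phi> \<le> pi / 2" "cos \<phi> = c"
    using c arccos_lbound[of c] arccos_le_pi2[of c] by (simp_all add: \<phi>_def cos_arccos)
  have "\<mu> * (pi - \<phi>) \<le> pi / 2"
  proof (cases "\<mu> \<le> 1 / 2")
    case True
    then show ?thesis
      using mult_mono[of \<mu> "1/2" "pi - \<phi>" pi] assms \<phi> by simp
  next
    case False
    \<comment> \<open>Here \<rho> = 1 - \<mu>, so \<open>c\<close> is 1/\<mu> - 1. The claim becomes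
      \<phi> \<ge> pi/2 - (pi/2)v; as cosine decreases on [0, pi], this is the chord bound v \<le>
      sin((pi/2)v).\<close>
    define v where "v = 1 / \<mu> - 1"
    have v: "0 \<le> v" "v \<le> 1"
      using False assms by (simp_all add: v_def field_simps)
    have "c = v"
      using False assms by (simp add: c_def \<rho>_def v_def min_def field_simps)
    have "cos (pi / 2 - pi / 2 * v) = sin (pi / 2 * v)"
      by (simp add: cos_diff)
    then have "cos \<phi> \<le> cos (pi / 2 - pi / 2 * v)"
      using sin_ge_chord[OF v] \<phi>(3) \<open>c = v\<close> by simp
    moreover have "0 \<le> pi / 2 - pi / 2 * v" "pi / 2 - pi / 2 * v \<le> pi"
    proof -
      have "0 \<le> pi / 2 * v" "pi / 2 * v \<le> pi / 2"
        using v mult_left_mono[of v 1 "pi / 2"] by simp_all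
      then show "0 \<le> pi / 2 - pi / 2 * v" "pi / 2 - pi / 2 * v \<le> pi"
        using pi_gt_zero by linarith+
    qed
    ultimately have "pi / 2 - pi / 2 * v \<le> \<phi>"
      using \<phi> pi_gt_zero by (subst (asm) cos_mono_le_eq) auto
    moreover have "pi / 2 * v = pi / 2 * (1 / \<mu>) - pi / 2"
      by (simp add: v_def right_diff_distrib)
    ultimately have "pi - \<phi> \<le> pi / 2 * (1 / \<mu>)"
      by linarith
    then show ?thesis
      using False by (simp add: field_simps)
  qed
  with \<phi> c show thesis
    using that by simp
qed

text \<open>With \<mu> = |1 - 2\<nu>|, the distance of \<nu> from 1/2 is \<mu>/2 and the smaller of
  \<nu> and 1 - \<nu> is (1 - \<mu>)/2.\<close>

lemma r1_eq: "2 * r1 \<nu> = min \<bar>1 - 2 * \<nu>\<bar> (1 - \<bar>1 - 2 * \<nu>\<bar>)"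
  by (auto simp: r1_def min_def abs_if)

section \<open>Passage to eigenbases and conclusion\<close>

theorem theorem4p4:
  fixes A B X :: "complex^'n^'n"
    and \<nu> :: real
    and N :: "complex^'n^'n \<Rightarrow> real"
  assumes "positive_definite_matrix A"
    and "positive_definite_matrix B"
    and "0 \<le> \<nu>" and "\<nu> \<le> 1"
    and "unitarily_invariant_norm N"
  shows "N (matrix_powr A \<nu> ** X ** matrix_powr B (1 - \<nu>) +
            matrix_powr A (1 - \<nu>) ** X ** matrix_powr B \<nu>)
       \<le> N ((4 * r1 \<nu>) *\<^sub>R (matrix_powr A (1/2) ** X ** matrix_powr B (1/2)) +
            (1 - 2 * r1 \<nu>) *\<^sub>R (A ** X + X ** B))"
proof -
  obtain U d where U: "unitary_matrix U" and d: "\<And>i. 0 < d i"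
    and A: "A = U ** real_diag_matrix d ** adjoint_matrix U"
    using positive_definite_spectral[OF assms(1)] by blast
  obtain V e where V: "unitary_matrix V" and e: "\<And>i. 0 < e i"
    and B: "B = V ** real_diag_matrix e ** adjoint_matrix V"
    using positive_definite_spectral[OF assms(2)] by blast
  \<comment> \<open>\<open>Y\<close> is \<open>X\<close> written in the two eigenbases;
    \<open>L\<close> undoes this change of bases and preserves the norm.\<close>
  define Y where "Y = adjoint_matrix U ** X ** V"
  define L where "L Z = U ** Z ** adjoint_matrix V" for Z
  have UV: "U ** adjoint_matrix U = mat 1" "V ** adjoint_matrix V = mat 1"
    using U V by (simp_all add: unitary_matrix_def)
  have L_add: "L (Z + Z') = L Z + L Z'" for Z Z'
    by (simp add: L_def matrix_matrix_mult_def vec_eq_iff sum.distrib algebra_simps)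
  have L_scaleR: "L (r *\<^sub>R Z) = r *\<^sub>R L Z" for r Z
    by (simp add: L_def matrix_matrix_mult_def vec_eq_iff flip: scaleR_sum_right)
  have NL: "N (L Z) = N Z" for Z
  proof -
    have "adjoint_matrix (adjoint_matrix V) = V"
      by (simp add: adjoint_matrix_def map_matrix_def transpose_def vec_eq_iff)
    then have "unitary_matrix (adjoint_matrix V)"
      using V by (simp add: unitary_matrix_def)
    then show ?thesis
      using assms(5) U by (simp add: L_def unitarily_invariant_norm_def)
  qed
  have powr: "matrix_powr A s ** X ** matrix_powr B t = L (schur (\<lambda>i j. d i powr s * e j powr t) Y)"
    for s t
    by (simp add: matrix_powr_eq[OF U d A] matrix_powr_eq[OF V e B] L_def Y_def matrix_mul_assoc
        flip: diag_mult_diag)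
  have one: "real_diag_matrix (\<lambda>_. 1) = mat 1"
    by (simp add: real_diag_matrix_def mat_def vec_eq_iff)
  have schur_d: "schur (\<lambda>i j. d i) Y = real_diag_matrix d ** Y"
    using diag_mult_diag[of d Y "\<lambda>_. 1"] by (simp add: one)
  have AX: "A ** X = L (schur (\<lambda>i j. d i) Y)"
    unfolding A schur_d unfolding L_def Y_def by (simp add: UV flip: matrix_mul_assoc)
  have schur_e: "schur (\<lambda>i j. e j) Y = Y ** real_diag_matrix e"
    using diag_mult_diag[of "\<lambda>_. 1" Y e] by (simp add: one)
  have XB: "X ** B = L (schur (\<lambda>i j. e j) Y)"
    unfolding B schur_e unfolding L_def Y_def by (simp add: UV matrix_mul_assoc)
  \<comment> \<open>Half logarithms let the factor \<open>g\<close>, twice the geometric mean of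
    \<open>d i\<close> and \<open>e j\<close>, split off both sides, leaving functions of
    \<open>p i - q j\<close>. It is absorbed into the matrix as \<open>schur g Y\<close>.\<close>
  define p where "p i = ln (d i) / 2" for i
  define q where "q j = ln (e j) / 2" for j
  have dp: "d i = exp (2 * p i)" and eq: "e i = exp (2 * q i)" for i
    using d[of i] e[of i] by (simp_all add: p_def q_def)
  define g where "g i j = 2 * exp (p i + q j)" for i j
  define \<mu> where "\<mu> = \<bar>1 - 2 * \<nu>\<bar>"
  have \<mu>: "0 \<le> \<mu>" "\<mu> \<le> 1"
    using assms by (auto simp: \<mu>_def)
  define \<rho> where "\<rho> = 2 * r1 \<nu>"
  obtain \<phi> where \<phi>: "0 \<le> \<phi>" "\<phi> \<le> pi / 2" "\<mu> * (pi - \<phi>) \<le> pi / 2" "\<rho> = (1 - \<rho>) * cos \<phi>"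
    using exists_angle[OF \<mu>] unfolding \<rho>_def r1_eq \<mu>_def .
  have "0 \<le> cos \<phi>"
    using \<phi> by (intro cos_ge_zero) auto
  then have inv: "1 - \<rho> = 1 / (1 + cos \<phi>)"
    using \<phi>(4) by (simp add: field_simps)
  have left: "d i powr \<nu> * e j powr (1 - \<nu>) + d i powr (1 - \<nu>) * e j powr \<nu> =
      cosh (\<mu> * (p i - q j)) * g i j" for i j
  proof -
    \<comment> \<open>Evenness of cosh removes the absolute value in \<mu>.\<close>
    have cosh_eq: "cosh (\<mu> * (p i - q j)) = cosh ((2 * \<nu> - 1) * (p i - q j))"
      by (auto simp: \<mu>_def abs_if algebra_simps simp flip: cosh_minus[of "(2 * \<nu> - 1) * (p i - q j)"])
    show ?thesis
      unfolding cosh_eq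
      by (simp add: dp eq g_def powr_def cosh_field_def algebra_simps flip: exp_add)
  qed
  have right: "2 * \<rho> * (d i powr (1/2) * e j powr (1/2)) + (1 - \<rho>) * (d i + e j) =
      (cosh (p i - q j) + cos \<phi>) / (1 + cos \<phi>) * g i j" for i j
  proof -
    have "d i + e j = cosh (p i - q j) * g i j"
      by (simp add: dp eq g_def cosh_field_def algebra_simps flip: exp_add)
    moreover have "2 * (d i powr (1/2) * e j powr (1/2)) = g i j"
      by (simp add: dp eq g_def powr_def exp_add)
    ultimately have "2 * \<rho> * (d i powr (1/2) * e j powr (1/2)) + (1 - \<rho>) * (d i + e j) =
        \<rho> * g i j + (1 - \<rho>) * (cosh (p i - q j) * g i j)"
      by simp
    \<comment> \<open>The choice of \<phi> turns the coefficient \<rho> into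
      \<open>(1 - \<rho>) * cos \<phi>\<close>, and \<open>1 - \<rho>\<close> is the normalising
      factor \<open>1 / (1 + cos \<phi>)\<close>.\<close>
    also have "\<dots> = (1 - \<rho>) * (cosh (p i - q j) + cos \<phi>) * g i j"
      by (subst (1) \<phi>(4)) (simp add: algebra_simps)
    finally show ?thesis
      by (simp add: inv)
  qed
  have "N (matrix_powr A \<nu> ** X ** matrix_powr B (1 - \<nu>) +
            matrix_powr A (1 - \<nu>) ** X ** matrix_powr B \<nu>) =
      N (schur (\<lambda>i j. cosh (\<mu> * (p i - q j))) (schur g Y))"
    by (simp add: powr NL schur_add left schur_schur flip: L_add)
  also have "\<dots> \<le> N (schur (\<lambda>i j. (cosh (p i - q j) + cos \<phi>) / (1 + cos \<phi>)) (schur g Y))"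
    by (rule norm_schur_cosh_le[OF assms(5) \<phi>(1,2) \<mu> \<phi>(3)])
  also have "\<dots> = N ((4 * r1 \<nu>) *\<^sub>R (matrix_powr A (1/2) ** X ** matrix_powr B (1/2)) +
            (1 - 2 * r1 \<nu>) *\<^sub>R (A ** X + X ** B))"
  proof -
    have "(4 * r1 \<nu>) *\<^sub>R (matrix_powr A (1/2) ** X ** matrix_powr B (1/2)) +
            (1 - 2 * r1 \<nu>) *\<^sub>R (A ** X + X ** B) =
        L (schur (\<lambda>i j. 2 * \<rho> * (d i powr (1/2) * e j powr (1/2)) + (1 - \<rho>) * (d i + e j)) Y)"
      unfolding powr AX XB \<rho>_def by (simp add: schur_add schur_scaleR flip: L_add L_scaleR)
    then show ?thesis
      by (simp only: right NL schur_schur)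
  qed
  finally show ?thesis .
qed

end
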